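(* Let $X$ be a finite topological space and let $A\subset X$. Then the closure of $A$ is $$\overline{A}=\{b\in X : b\leq a \text{ for some } a\in A\}.$$
   Context: For a point $x$ of a finite topological space $X$, $U_x$ denotes the intersection of all open sets containing $x$, i.e. the smallest open set containing $x$. For $x,y\in X$ one writes $y\geq x$ (equivalently $x\leq y$) if $U_y\subseteq U_x$. *)

theory Defs
  imports "HOL-Analysis.Abstract_Topology"
begin

(* A finite topological space is a topology X with finite (topspace X).
   Both notions below are only meaningful for points of topspace X: for other points
   the intersection is taken over the empty family and yields UNIV. *)

definition min_open :: "'a topology \<Rightarrow> 'a \<Rightarrow> 'a set" where
  "min_open X x = \<Inter>{U. openin X U \<and> x \<in> U}"

definition top_le :: "'a topology \<Rightarrow> 'a \<Rightarrow> 'a \<Rightarrow> bool" where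
  "top_le X x y \<longleftrightarrow> min_open X y \<subseteq> min_open X x"

end

theory Submission
  imports Defs
begin

text \<open>
  By finiteness \<open>min_open X b\<close> is itself open, so \<open>b\<close> lies in the closure of \<open>A\<close> as soon as this
  single neighbourhood meets \<open>A\<close>; and \<open>a \<in> min_open X b\<close> just says \<open>b \<le> a\<close>.
\<close>

lemma mem_min_open: "x \<in> min_open X x"
  by (simp add: min_open_def)

lemma min_open_subset: "openin X U \<Longrightarrow> x \<in> U \<Longrightarrow> min_open X x \<subseteq> U"
  by (auto simp: min_open_def)

text \<open>Open sets are subsets of the finite \<open>topspace X\<close>, so the intersection runs
  over a finite family.\<close>

lemma openin_min_open:
  assumes "finite (topspace X)" and "x \<in> topspace X"
  shows "openin X (min_open X x)"
  unfolding min_open_def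
proof (rule openin_Inter)
  have "{U. openin X U \<and> x \<in> U} \<subseteq> Pow (topspace X)"
    using openin_subset by blast
  with assms(1) show "finite {U. openin X U \<and> x \<in> U}"
    by (meson finite_Pow_iff finite_subset)
  \<comment> \<open>\<open>topspace X\<close> is a member; an empty family would intersect to
    \<open>UNIV\<close>.\<close>
  show "{U. openin X U \<and> x \<in> U} \<noteq> {}"
    using assms(2) by blast
qed auto

text \<open>Forwards, \<open>y\<close> lies in \<open>min_open X y\<close>; backwards,
  \<open>min_open X x\<close> is an open set around \<open>y\<close>, so it contains the smallest
  one.\<close>

lemma top_le_iff_mem_min_open:
  assumes "finite (topspace X)" and "x \<in> topspace X"
  shows "top_le X x y \<longleftrightarrow> y \<in> min_open X x"
  unfolding top_le_def
  using mem_min_open[of y X] min_open_subset[OF openin_min_open[OF assms], of y] by blast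

theorem proposition3p3:
  fixes X :: "'a topology" and A :: "'a set"
  assumes "finite (topspace X)" and "A \<subseteq> topspace X"
  shows "X closure_of A = {b \<in> topspace X. \<exists>a\<in>A. top_le X b a}"
proof -
  \<comment> \<open>The left side is the condition on \<open>b\<close> in
    \<open>closure_of_def\<close>.\<close>
  have "(\<forall>T. b \<in> T \<and> openin X T \<longrightarrow> (\<exists>y\<in>A. y \<in> T)) \<longleftrightarrow> (\<exists>a\<in>A. top_le X b a)"
    if b: "b \<in> topspace X" for b
  proof -
    have "(\<forall>T. b \<in> T \<and> openin X T \<longrightarrow> (\<exists>y\<in>A. y \<in> T)) \<longleftrightarrow> (\<exists>a\<in>A. a \<in> min_open X b)"
    proof
      assume "\<forall>T. b \<in> T \<and> openin X T \<longrightarrow> (\<exists>y\<in>A. y \<in> T)"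
      then show "\<exists>a\<in>A. a \<in> min_open X b"
        \<comment> \<open>Take \<open>T\<close> to be \<open>min_open X b\<close>.\<close>
        by (simp add: mem_min_open openin_min_open[OF assms(1) b])
    next
      assume "\<exists>a\<in>A. a \<in> min_open X b"
      then show "\<forall>T. b \<in> T \<and> openin X T \<longrightarrow> (\<exists>y\<in>A. y \<in> T)"
        \<comment> \<open>The same \<open>a\<close> serves for every \<open>T\<close>, since
          \<open>min_open X b\<close> lies inside \<open>T\<close>.\<close>
        by (meson min_open_subset subsetD)
    qed
    then show ?thesis
      by (simp add: top_le_iff_mem_min_open[OF assms(1) b])
  qed
  then show ?thesis
    unfolding closure_of_def by (intro Collect_cong conj_cong refl)
qed

end
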